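(* Let $S$ be a semigroup having minimal left ideals, and suppose that the intersection ideal graph $\Gamma(S)$ is connected. Then $\operatorname{diam}(\Gamma(S))=2$ if and only if $S$ has at least two minimal left ideals.
   Context: A left ideal of a semigroup $S$ is a non-empty subset $I\subseteq S$ with $SI\subseteq I$; it is nontrivial if $I\neq S$. The intersection of two left ideals is nontrivial if it is non-empty. Minimal left ideals are understood to be nontrivial: a nontrivial left ideal is minimal if it does not properly contain any left ideal of $S$. The intersection ideal graph $\Gamma(S)$ is the simple undirected graph whose vertices are the nontrivial left ideals of $S$, with two distinct vertices $I,J$ adjacent if and only if $I\cap J$ is nontrivial. The diameter is the greatest distance between any pair of vertices. *)

theory Defs
  imports "Graph_Theory.Graph_Theory"
begin

definition left_ideal :: "'a::semigroup_mult set \<Rightarrow> bool" where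
  "left_ideal I \<longleftrightarrow> I \<noteq> {} \<and> {s * x | s x. x \<in> I} \<subseteq> I"

definition nontrivial_left_ideal :: "'a::semigroup_mult set \<Rightarrow> bool" where
  "nontrivial_left_ideal I \<longleftrightarrow> left_ideal I \<and> I \<noteq> UNIV"

definition minimal_left_ideal :: "'a::semigroup_mult set \<Rightarrow> bool" where
  "minimal_left_ideal I \<longleftrightarrow>
     nontrivial_left_ideal I \<and> \<not> (\<exists>J. left_ideal J \<and> J \<subset> I)"

text \<open>
  A simple undirected graph is encoded as a symmetric loop-free digraph, each edge being
  represented by its two orientations. The semigroup is the whole type, so the graph is
  determined by the type \<open>'a\<close> alone.
\<close>

definition intersection_ideal_graph :: "'a::semigroup_mult set pair_pre_digraph" where
  "intersection_ideal_graph =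
     \<lparr> pverts = {I. nontrivial_left_ideal I},
       parcs = {(I, J). nontrivial_left_ideal I \<and> nontrivial_left_ideal J \<and>
                        I \<noteq> J \<and> I \<inter> J \<noteq> {}} \<rparr>"

lemma pair_bidirected_intersection_ideal_graph:
  "pair_bidirected_digraph (intersection_ideal_graph :: 'a::semigroup_mult set pair_pre_digraph)"
  by unfold_locales
     (auto simp: intersection_ideal_graph_def arcs_ends_conv symmetric_def sym_def)

text \<open>
  The distance of two vertices is the least number of edges of a walk joining them, that is, the
  shortest-path cost for unit edge weights, and \<open>\<infinity>\<close> if there is no such walk. As distances
  are natural numbers or \<open>\<infinity>\<close>, a finite supremum over a non-empty vertex set is attained, so it
  is the greatest distance. The constant \<open>wf_digraph.\<mu>\<close> is specified only for
  well-formed digraphs; the lemma above shows that the intersection ideal graph is one.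
\<close>

definition graph_dist :: "('a, 'b) pre_digraph \<Rightarrow> 'a \<Rightarrow> 'a \<Rightarrow> ereal" where
  "graph_dist G u v = wf_digraph.\<mu> G (\<lambda>_. 1) u v"

definition graph_diameter :: "('a, 'b) pre_digraph \<Rightarrow> ereal" where
  "graph_diameter G = (SUP (u, v) \<in> verts G \<times> verts G. graph_dist G u v)"

end

theory Submission
  imports Defs
begin

text \<open>
  If \<open>M\<close> is a minimal left ideal, then so is every right translate \<open>M x\<close> that is not
  the whole semigroup. Hence one minimal left ideal is enough for every nontrivial left ideal
  \<open>L\<close> to contain a minimal one, namely \<open>M x\<close> with \<open>x \<in> L\<close>. If \<open>M\<close> is the only minimal left
  ideal, all vertices contain \<open>M\<close> and the graph is complete. If there are two, they are disjoint,
  so the diameter is at least 2. Conversely, disjoint \<open>I\<close> and \<open>J\<close> contain minimal \<open>I'\<close> and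
  \<open>J'\<close>, and \<open>I' \<union> J'\<close> is a common neighbour unless it is everything; in that case \<open>I\<close> and
  \<open>J\<close> are themselves minimal with union the whole semigroup, and \<open>I\<close> is an isolated vertex.
\<close>

section \<open>Distances in digraphs\<close>

lemma awalk_cost_unit:
  fixes G :: "('a, 'b) pre_digraph" and p :: "'b awalk"
  assumes "wf_digraph G"
  shows "wf_digraph.awalk_cost (\<lambda>_. 1) p = real (length p)"
  by (simp add: wf_digraph.awalk_cost_def[OF assms] sum_list_triv)

text \<open>Turns an explicit walk into an upper bound for the distance; it is applied below to
  walks with 0, 1 and 2 arcs.\<close>

lemma graph_dist_le_length:
  assumes "wf_digraph G" and "pre_digraph.awalk G u p v"
  shows "graph_dist G u v \<le> real (length p)"
  using wf_digraph.min_cost_le_walk_cost[OF assms, of "\<lambda>_. 1"]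
  by (simp add: graph_dist_def awalk_cost_unit[OF assms(1)])

lemma graph_dist_refl_le:
  assumes "wf_digraph G" and "u \<in> verts G"
  shows "graph_dist G u u \<le> 0"
  using graph_dist_le_length[of G u "[]" u] assms
  by (simp add: wf_digraph.awalk_Nil_iff zero_ereal_def)

lemma graph_dist_adj_le:
  assumes "wf_digraph G" and "u \<rightarrow>\<^bsub>G\<^esub> v"
  shows "graph_dist G u v \<le> 1"
proof -
  interpret wf_digraph G by fact
  obtain e where "e \<in> arcs G" "tail G e = u" "head G e = v"
    using assms(2) by auto
  then have "awalk u [e] v"
    by (auto simp: awalk_def)
  then show ?thesis
    using graph_dist_le_length[OF assms(1), of u "[e]" v] by (simp add: one_ereal_def)
qed

lemma graph_dist_adj_adj_le:
  assumes "wf_digraph G" and "u \<rightarrow>\<^bsub>G\<^esub> w" and "w \<rightarrow>\<^bsub>G\<^esub> v"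
  shows "graph_dist G u v \<le> 2"
proof -
  interpret wf_digraph G by fact
  obtain e f where "e \<in> arcs G" "tail G e = u" "head G e = w"
    and "f \<in> arcs G" "tail G f = w" "head G f = v"
    using assms(2,3) by (metis reachableE)
  then have "awalk u [e, f] v"
    by (auto simp: awalk_def)
  then show ?thesis
    using graph_dist_le_length[OF assms(1), of u "[e, f]" v] by simp
qed

text \<open>A walk without arcs would force \<open>u = v\<close>, and a walk with one arc would make
  the vertices adjacent. If no walk exists, the infimum is \<infinity> and the bound still
  holds.\<close>

lemma graph_dist_nonadj_ge:
  assumes "wf_digraph G" and "u \<noteq> v" and "\<not> u \<rightarrow>\<^bsub>G\<^esub> v"
  shows "2 \<le> graph_dist G u v"
proof -
  interpret wf_digraph G by fact
  have "2 \<le> length p" if "awalk u p v" for p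
  proof (rule ccontr)
    assume "\<not> 2 \<le> length p"
    then consider "p = []" | e where "p = [e]"
      by (cases p; cases "tl p") auto
    then show False
    proof cases
      case 1
      with that assms(2) show False by (simp add: awalk_Nil_iff)
    next
      case 2
      with that assms(3) show False by (auto simp: awalk_def arcs_ends_conv)
    qed
  qed
  then show ?thesis
    unfolding graph_dist_def \<mu>_def
    by (intro INF_greatest) (simp add: awalk_cost_unit[OF assms(1)])
qed

section \<open>Left ideals\<close>

lemma left_ideal_iff: "left_ideal I \<longleftrightarrow> I \<noteq> {} \<and> (\<forall>s. \<forall>x\<in>I. s * x \<in> I)"
  by (auto simp: left_ideal_def)

lemma left_ideal_Un: "left_ideal I \<Longrightarrow> left_ideal J \<Longrightarrow> left_ideal (I \<union> J)"
  by (auto simp: left_ideal_iff)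

lemma left_ideal_Int: "left_ideal I \<Longrightarrow> left_ideal J \<Longrightarrow> I \<inter> J \<noteq> {} \<Longrightarrow> left_ideal (I \<inter> J)"
  by (auto simp: left_ideal_iff)

text \<open>\<open>M \<inter> I\<close> is a left ideal inside \<open>M\<close>, so minimality makes
  it all of \<open>M\<close>.\<close>

lemma minimal_left_ideal_subset:
  assumes "minimal_left_ideal M" and "left_ideal I" and "M \<inter> I \<noteq> {}"
  shows "M \<subseteq> I"
  using assms left_ideal_Int[of M I]
  by (auto simp: minimal_left_ideal_def nontrivial_left_ideal_def)

lemma minimal_left_ideals_disjoint:
  assumes "minimal_left_ideal M" and "minimal_left_ideal N" and "M \<noteq> N"
  shows "M \<inter> N = {}"
  using minimal_left_ideal_subset[of M N] minimal_left_ideal_subset[of N M] assms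
  by (auto simp: minimal_left_ideal_def nontrivial_left_ideal_def)

lemma minimal_left_ideal_translate:
  fixes M :: "'a::semigroup_mult set"
  assumes "minimal_left_ideal M" and "(\<lambda>m. m * x) ` M \<noteq> UNIV"
  shows "minimal_left_ideal ((\<lambda>m. m * x) ` M)"
proof -
  have M: "left_ideal M"
    using assms(1) by (simp add: minimal_left_ideal_def nontrivial_left_ideal_def)
  then have "left_ideal ((\<lambda>m. m * x) ` M)"
    unfolding left_ideal_iff by (auto simp flip: mult.assoc)
  moreover have "(\<lambda>m. m * x) ` M \<subseteq> J" if J: "left_ideal J" "J \<subseteq> (\<lambda>m. m * x) ` M" for J
  proof -
    \<comment> \<open>The preimage of \<open>J\<close> under right multiplication by
      \<open>x\<close> is a left ideal by associativity. It meets \<open>M\<close> because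
      \<open>J\<close> is a non-empty part of the image of \<open>M\<close>, so it contains
      \<open>M\<close>.\<close>
    have "left_ideal {m. m * x \<in> J}" and "M \<inter> {m. m * x \<in> J} \<noteq> {}"
      using J by (auto simp: left_ideal_iff mult.assoc)
    then have "M \<subseteq> {m. m * x \<in> J}"
      by (rule minimal_left_ideal_subset[OF assms(1)])
    then show ?thesis by auto
  qed
  ultimately show ?thesis
    using assms(2) by (auto simp: minimal_left_ideal_def nontrivial_left_ideal_def)
qed

lemma nontrivial_left_ideal_contains_minimal:
  fixes M L :: "'a::semigroup_mult set"
  assumes "minimal_left_ideal M" and "nontrivial_left_ideal L"
  obtains N where "minimal_left_ideal N" and "N \<subseteq> L"
proof -
  obtain x where "x \<in> L"
    using assms(2) by (auto simp: nontrivial_left_ideal_def left_ideal_iff)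
  then have "(\<lambda>m. m * x) ` M \<subseteq> L"
    using assms(2) by (auto simp: nontrivial_left_ideal_def left_ideal_iff)
  \<comment> \<open>The translate lies in the proper subset \<open>L\<close>, so it cannot be the
    whole semigroup.\<close>
  moreover from this have "minimal_left_ideal ((\<lambda>m. m * x) ` M)"
    using assms by (intro minimal_left_ideal_translate) (auto simp: nontrivial_left_ideal_def)
  ultimately show ?thesis using that by blast
qed

section \<open>The intersection ideal graph\<close>

lemma pverts_intersection_ideal_graph [simp]:
  "I \<in> pverts intersection_ideal_graph \<longleftrightarrow> nontrivial_left_ideal I"
  by (simp add: intersection_ideal_graph_def)

lemma parcs_intersection_ideal_graph [simp]:
  "(I, J) \<in> parcs intersection_ideal_graph \<longleftrightarrow>
     nontrivial_left_ideal I \<and> nontrivial_left_ideal J \<and> I \<noteq> J \<and> I \<inter> J \<noteq> {}"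
  by (simp add: intersection_ideal_graph_def)

lemma wf_digraph_intersection_ideal_graph: "wf_digraph (with_proj intersection_ideal_graph)"
  by unfold_locales auto

text \<open>Connectedness ignores the orientation of arcs, but the graph is symmetric, so
  \<open>J\<close> is reachable from \<open>I\<close> along arcs. The first arc of such a path gives
  \<open>K\<close>.\<close>

lemma connected_imp_neighbour:
  fixes I J :: "'a::semigroup_mult set"
  assumes "Digraph_Component.connected
             (with_proj (intersection_ideal_graph :: 'a set pair_pre_digraph))"
    and "nontrivial_left_ideal I" and "nontrivial_left_ideal J" and "I \<noteq> J"
  obtains K where "nontrivial_left_ideal K" and "K \<noteq> I" and "I \<inter> K \<noteq> {}"
proof -
  let ?G = "intersection_ideal_graph :: 'a set pair_pre_digraph"
  interpret pair_bidirected_digraph ?G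
    by (rule pair_bidirected_intersection_ideal_graph)
  have "strongly_connected (with_proj ?G)"
    using symmetric_connected_imp_strongly_connected[OF pair_sym_arcs assms(1)] .
  then have "I \<rightarrow>\<^sup>*\<^bsub>with_proj ?G\<^esub> J"
    using assms(2,3) by (auto simp: strongly_connected_def)
  then obtain K where "I \<rightarrow>\<^bsub>with_proj ?G\<^esub> K"
    using assms(4) by (metis pre_digraph.converse_reachable_cases)
  then show ?thesis using that[of K] by auto
qed

lemma graph_dist_le_2:
  fixes M I J :: "'a::semigroup_mult set"
  defines "G \<equiv> with_proj (intersection_ideal_graph :: 'a set pair_pre_digraph)"
  assumes M: "minimal_left_ideal M" and conn: "Digraph_Component.connected G"
    and I: "nontrivial_left_ideal I" and J: "nontrivial_left_ideal J"
  shows "graph_dist G I J \<le> 2"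
proof -
  have wf: "wf_digraph G"
    unfolding G_def by (rule wf_digraph_intersection_ideal_graph)
  consider "I = J" | "I \<noteq> J" "I \<inter> J \<noteq> {}" | "I \<inter> J = {}" by auto
  then show ?thesis
  proof cases
    case 1
    then have "graph_dist G I J \<le> 0"
      using graph_dist_refl_le[OF wf] I by (simp add: G_def)
    then show ?thesis by (rule order_trans) simp
  next
    case 2
    then have "graph_dist G I J \<le> 1"
      using graph_dist_adj_le[OF wf, of I J] I J by (simp add: G_def)
    then show ?thesis by (rule order_trans) simp
  next
    case 3
    obtain I' where I': "minimal_left_ideal I'" "I' \<subseteq> I"
      using nontrivial_left_ideal_contains_minimal[OF M I] .
    obtain J' where J': "minimal_left_ideal J'" "J' \<subseteq> J"
      using nontrivial_left_ideal_contains_minimal[OF M J] .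
    have ne: "I' \<noteq> {}" "J' \<noteq> {}" and li: "left_ideal I'" "left_ideal J'"
      using I' J' by (auto simp: minimal_left_ideal_def nontrivial_left_ideal_def left_ideal_iff)
    have "I' \<union> J' \<noteq> UNIV"
    proof
      assume *: "I' \<union> J' = UNIV"
      \<comment> \<open>A point of \<open>I\<close> outside \<open>I'\<close> would lie in
        \<open>J'\<close>, hence in \<open>J\<close>, against disjointness; likewise for
        \<open>J\<close>.\<close>
      with 3 I' J' have eq: "I = I'" "J = J'" by blast+
      have "I \<noteq> J" using 3 ne eq by auto
      \<comment> \<open>A neighbour \<open>K\<close> of \<open>I\<close> contains the minimal
        \<open>I\<close> properly, so it meets the complement \<open>J\<close> and contains that
        too. Then \<open>K\<close> is everything, a contradiction.\<close>
      then obtain K where K: "nontrivial_left_ideal K" "K \<noteq> I" "I \<inter> K \<noteq> {}"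
        using connected_imp_neighbour[OF conn[unfolded G_def] I J] by blast
      then have "left_ideal K" by (simp add: nontrivial_left_ideal_def)
      with K(3) have "I \<subseteq> K"
        using minimal_left_ideal_subset[of I' K] I' eq by simp
      with K(2) * eq have "J \<inter> K \<noteq> {}" by blast
      with \<open>left_ideal K\<close> have "J \<subseteq> K"
        using minimal_left_ideal_subset[of J' K] J' eq by simp
      with \<open>I \<subseteq> K\<close> * eq K(1) show False
        by (auto simp: nontrivial_left_ideal_def)
    qed
    then have "nontrivial_left_ideal (I' \<union> J')"
      using left_ideal_Un[OF li] by (simp add: nontrivial_left_ideal_def)
    \<comment> \<open>The union differs from \<open>I\<close> because it contains the non-empty
      \<open>J'\<close>, which is disjoint from \<open>I\<close>; symmetrically for
      \<open>J\<close>.\<close>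
    moreover have "I \<inter> (I' \<union> J') \<noteq> {}" "(I' \<union> J') \<inter> J \<noteq> {}" "I \<noteq> I' \<union> J'" "I' \<union> J' \<noteq> J"
      using ne I'(2) J'(2) 3 by blast+
    ultimately show ?thesis
      using graph_dist_adj_adj_le[OF wf, of I "I' \<union> J'" J] I J by (simp add: G_def)
  qed
qed

theorem theorem3p7:
  fixes \<Gamma> :: "'a::semigroup_mult set pair_pre_digraph"
  defines "\<Gamma> \<equiv> intersection_ideal_graph"
  assumes "\<exists>I :: 'a set. minimal_left_ideal I"
    and "Digraph_Component.connected (with_proj \<Gamma>)"
  shows "graph_diameter (with_proj \<Gamma>) = 2 \<longleftrightarrow>
           (\<exists>I J :: 'a set. minimal_left_ideal I \<and> minimal_left_ideal J \<and> I \<noteq> J)"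
proof
  have wf: "wf_digraph (with_proj \<Gamma>)"
    unfolding \<Gamma>_def by (rule wf_digraph_intersection_ideal_graph)
  obtain M :: "'a set" where M: "minimal_left_ideal M"
    using assms(2) by blast
  {
    assume diam: "graph_diameter (with_proj \<Gamma>) = 2"
    show "\<exists>I J :: 'a set. minimal_left_ideal I \<and> minimal_left_ideal J \<and> I \<noteq> J"
    proof (rule ccontr)
      assume "\<not> ?thesis"
      then have uniq: "N = M" if "minimal_left_ideal N" for N
        using M that by blast
      have sub: "M \<subseteq> I" if "nontrivial_left_ideal I" for I
        using nontrivial_left_ideal_contains_minimal[OF M that] uniq by metis
      have "M \<noteq> {}"
        using M by (simp add: minimal_left_ideal_def nontrivial_left_ideal_def left_ideal_def)
      have "graph_dist (with_proj \<Gamma>) I J \<le> 1"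
        if "nontrivial_left_ideal I" "nontrivial_left_ideal J" for I J
      proof (cases "I = J")
        case True
        then have "graph_dist (with_proj \<Gamma>) I J \<le> 0"
          using graph_dist_refl_le[OF wf] that by (simp add: \<Gamma>_def)
        then show ?thesis by (rule order_trans) simp
      next
        case False
        moreover have "I \<inter> J \<noteq> {}"
          using sub[OF that(1)] sub[OF that(2)] \<open>M \<noteq> {}\<close> by blast
        ultimately show ?thesis
          using graph_dist_adj_le[OF wf, of I J] that by (simp add: \<Gamma>_def)
      qed
      \<comment> \<open>Only an inequality holds here: the diameter is 0 if \<open>M\<close> is the
        only vertex.\<close>
      then have "graph_diameter (with_proj \<Gamma>) \<le> 1"
        unfolding graph_diameter_def by (intro SUP_least) (auto simp: \<Gamma>_def)
      with diam show False by simp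
    qed
  }
  assume "\<exists>I J :: 'a set. minimal_left_ideal I \<and> minimal_left_ideal J \<and> I \<noteq> J"
  then obtain I J :: "'a set" where IJ: "minimal_left_ideal I" "minimal_left_ideal J" "I \<noteq> J"
    by blast
  show "graph_diameter (with_proj \<Gamma>) = 2"
  proof (rule antisym)
    show "graph_diameter (with_proj \<Gamma>) \<le> 2"
      unfolding graph_diameter_def
      using graph_dist_le_2[OF M] assms(3) by (intro SUP_least) (auto simp: \<Gamma>_def)
    \<comment> \<open>Disjointness makes \<open>I\<close> and \<open>J\<close> non-adjacent, and
      this single pair bounds the supremum from below.\<close>
    have "2 \<le> graph_dist (with_proj \<Gamma>) I J"
      using minimal_left_ideals_disjoint[OF IJ] IJ(3)
      by (intro graph_dist_nonadj_ge[OF wf]) (auto simp: \<Gamma>_def)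
    also have "\<dots> \<le> graph_diameter (with_proj \<Gamma>)"
      unfolding graph_diameter_def
      using IJ(1,2) by (intro SUP_upper2[of "(I, J)"]) (auto simp: \<Gamma>_def minimal_left_ideal_def)
    finally show "2 \<le> graph_diameter (with_proj \<Gamma>)" .
  qed
qed

end
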